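(* Let $R$ be a commutative ring with $1$ and let $A$ be an $n\times n$ matrix with entries in $R$ such that $A_{ii}=2$ for all $1\leq i\leq n$. Let $r_1^A,\dots,r_n^A$ be the reflections defined by $A$ and let $A_+$, $A_-$ be the upper unitriangular matrices associated with $A$. Then $$r_1^A r_2^A\cdots r_n^A=-A_+^{-1}A_-^t.$$
   Context: Here $2$ means $1+1$ in $R$. Let $e_1,\dots,e_n$ be the standard basis of $R^n$ (column vectors); matrices act on the left and $M^t$ denotes the transpose of $M$. For $1\le i\le n$ the reflection $r_i^A$ is the $R$-linear map (matrix) defined by $r_i^A(e_j)=e_j-A_{ij}e_i$ for $1\leq j\leq n$. The $n\times n$ matrices $A_+$ and $A_-$ are defined by: $(A_+)_{ij}=A_{ij}$ if $i<j$, $1$ if $i=j$, and $0$ if $i>j$; and $(A_-)_{ij}=A_{ji}$ if $i<j$, $1$ if $i=j$, and $0$ if $i>j$. Both are invertible, and $A=A_++A_-^t$. *)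

theory Defs
  imports "Jordan_Normal_Form.Determinant"
begin

text \<open>
  Indices run over \<open>0, \<dots>, n - 1\<close> instead of \<open>1, \<dots>, n\<close>, following the matrix library;
  the size \<open>n\<close> is read off from the matrix \<open>A\<close>.
\<close>

definition reflection :: "'a :: comm_ring_1 mat \<Rightarrow> nat \<Rightarrow> 'a mat" where
  "reflection A i = (let n = dim_row A in
     mat_of_cols n (map (\<lambda>j. unit_vec n j - A $$ (i, j) \<cdot>\<^sub>v unit_vec n i) [0..<n]))"

lemma reflection_unit_vec:
  assumes "A \<in> carrier_mat n n" "i < n" "j < n"
  shows "reflection A i *\<^sub>v unit_vec n j = unit_vec n j - A $$ (i, j) \<cdot>\<^sub>v unit_vec n i"
proof -
  have c: "reflection A i \<in> carrier_mat n n"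
    using assms by (auto simp: reflection_def Let_def mat_of_cols_def)
  have "reflection A i *\<^sub>v unit_vec n j = col (reflection A i) j"
    using c assms(3) by (intro eq_vecI) (auto simp: col_def)
  also have "\<dots> = unit_vec n j - A $$ (i, j) \<cdot>\<^sub>v unit_vec n i"
    using assms by (auto simp: reflection_def Let_def)
  finally show ?thesis .
qed

text \<open>The matrix product from left to right of the reflections, the first one being leftmost.\<close>

definition reflection_prod :: "'a :: comm_ring_1 mat \<Rightarrow> 'a mat" where
  "reflection_prod A = foldr (*) (map (reflection A) [0..<dim_row A]) (1\<^sub>m (dim_row A))"

definition A_plus :: "'a :: comm_ring_1 mat \<Rightarrow> 'a mat" where
  "A_plus A = mat (dim_row A) (dim_row A)
     (\<lambda>(i, j). if i < j then A $$ (i, j) else if i = j then 1 else 0)"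

definition A_minus :: "'a :: comm_ring_1 mat \<Rightarrow> 'a mat" where
  "A_minus A = mat (dim_row A) (dim_row A)
     (\<lambda>(i, j). if i < j then A $$ (j, i) else if i = j then 1 else 0)"

lemma A_plus_minus_decomp:
  assumes "A \<in> carrier_mat n n" "\<And>i. i < n \<Longrightarrow> A $$ (i, i) = 2"
  shows "A = A_plus A + transpose_mat (A_minus A)"
  using assms by (intro eq_matI) (auto simp: A_plus_def A_minus_def)

text \<open>
  The inverse in the ring of \<open>n \<times> n\<close> matrices; meaningful for units of that ring only.
\<close>

definition mat_inv :: "'a :: comm_ring_1 mat \<Rightarrow> 'a mat" where
  "mat_inv M = inv\<^bsub>ring_mat TYPE('a) (dim_row M) ()\<^esub> M"

lemma unitriangular_Units:
  fixes M :: "'a :: comm_ring_1 mat"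
  assumes M: "M \<in> carrier_mat n n" and "upper_triangular M"
    and d: "\<And>i. i < n \<Longrightarrow> M $$ (i, i) = 1"
  shows "M \<in> Units (ring_mat TYPE('a) n ())"
proof -
  have "diag_mat M = replicate n 1"
    using M d by (intro nth_equalityI) (auto simp: diag_mat_def)
  hence "det M = 1"
    using det_upper_triangular[OF assms(2) M] by simp
  moreover have one_smult: "1 \<cdot>\<^sub>m 1\<^sub>m n = (1\<^sub>m n :: 'a mat)"
    by (intro eq_matI) auto
  ultimately have "M * adj_mat M = 1\<^sub>m n" "adj_mat M * M = 1\<^sub>m n"
    using adj_mat[OF M] by (simp_all add: one_smult)
  thus ?thesis
    using M adj_mat(1)[OF M] unfolding Units_def ring_mat_simps by blast
qed

lemma A_plus_Units:
  fixes A :: "'a :: comm_ring_1 mat"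
  assumes "A \<in> carrier_mat n n"
  shows "A_plus A \<in> Units (ring_mat TYPE('a) n ())"
  using assms by (intro unitriangular_Units) (auto simp: A_plus_def)

lemma A_minus_Units:
  fixes A :: "'a :: comm_ring_1 mat"
  assumes "A \<in> carrier_mat n n"
  shows "A_minus A \<in> Units (ring_mat TYPE('a) n ())"
  using assms by (intro unitriangular_Units) (auto simp: A_minus_def)

lemma mat_inv_inverse:
  fixes M :: "'a :: comm_ring_1 mat"
  assumes "M \<in> Units (ring_mat TYPE('a) n ())"
  shows "mat_inv M \<in> carrier_mat n n" "M * mat_inv M = 1\<^sub>m n" "mat_inv M * M = 1\<^sub>m n"
proof -
  interpret R: ring "ring_mat TYPE('a) n ()" by (rule ring_mat)
  have "dim_row M = n"
    using assms R.Units_closed[OF assms] by (simp add: ring_mat_simps)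
  thus "mat_inv M \<in> carrier_mat n n" "M * mat_inv M = 1\<^sub>m n" "mat_inv M * M = 1\<^sub>m n"
    using R.Units_inv_closed[OF assms] R.Units_r_inv[OF assms] R.Units_l_inv[OF assms]
    by (simp_all add: mat_inv_def ring_mat_simps)
qed

end

theory Submission
  imports Defs
begin

text \<open>
  Left multiplication by the reflection with index \<open>k\<close> changes row \<open>k\<close> only. So in the tail
  product \<open>Q\<close> of the reflections with indices \<open>k, \<dots>, n - 1\<close> the rows above \<open>k\<close> are
  those of the identity, and downward induction on \<open>k\<close> shows that the rows of \<open>A_plus A * Q\<close>
  from \<open>k\<close> on are those of \<open>- transpose_mat (A_minus A)\<close>: since \<open>A_plus A\<close> is upper triangular,
  only row \<open>k\<close> is new, and there \<open>A_plus A - A = - transpose_mat (A_minus A)\<close> meets only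
  identity rows.
\<close>

lemma reflection_carrier:
  "A \<in> carrier_mat n n \<Longrightarrow> reflection A i \<in> carrier_mat n n"
  by (auto simp: reflection_def Let_def mat_of_cols_def)

lemma reflection_index:
  assumes "A \<in> carrier_mat n n" "i < n" "j < n"
  shows "reflection A k $$ (i, j) = of_bool (i = j) - of_bool (i = k) * A $$ (k, j)"
  using assms by (auto simp: reflection_def Let_def mat_of_cols_def unit_vec_def)

text \<open>For \<open>k < n\<close> the reflection is the identity minus the matrix whose row
  \<open>k\<close> is row \<open>k\<close> of \<open>A\<close> and whose other rows vanish. The
  subtracted sum is the entry of \<open>A * Q\<close> at \<open>(k, c)\<close>.\<close>

lemma reflection_mult_index:
  assumes A: "A \<in> carrier_mat n n" and Q: "Q \<in> carrier_mat n n" and "i < n" "c < n"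
  shows "(reflection A k * Q) $$ (i, c) =
    Q $$ (i, c) - of_bool (i = k) * (\<Sum>j<n. A $$ (k, j) * Q $$ (j, c))"
proof -
  have "(reflection A k * Q) $$ (i, c) = (\<Sum>j<n. reflection A k $$ (i, j) * Q $$ (j, c))"
    using assms reflection_carrier[OF A, of k]
    by (auto simp: scalar_prod_def lessThan_atLeast0 intro!: sum.cong)
  also have "\<dots> = (\<Sum>j<n. of_bool (i = j) * Q $$ (j, c)
      - of_bool (i = k) * (A $$ (k, j) * Q $$ (j, c)))"
    using assms by (intro sum.cong) (auto simp: reflection_index[OF A] algebra_simps)
  also have "\<dots> = (\<Sum>j<n. of_bool (i = j) * Q $$ (j, c))
      - of_bool (i = k) * (\<Sum>j<n. A $$ (k, j) * Q $$ (j, c))"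
    by (simp add: sum_subtractf sum_distrib_left)
  also have "(\<Sum>j<n. of_bool (i = j) * Q $$ (j, c)) = Q $$ (i, c)"
    using \<open>i < n\<close> by (simp add: of_bool_def if_distrib[of "\<lambda>x. x * _"] cong: if_cong)
  finally show ?thesis .
qed

lemma tail_prod_carrier:
  assumes "A \<in> carrier_mat n n"
  shows "foldr (*) (map (reflection A) ks) (1\<^sub>m n) \<in> carrier_mat n n"
  using assms by (induction ks) (auto intro: mult_carrier_mat reflection_carrier)

text \<open>Both claims share one induction: the new row in the second is computed from the identity
  rows that the first provides for the shorter tail.\<close>

lemma tail_prod_rows:
  fixes A :: "'a :: comm_ring_1 mat"
  assumes A: "A \<in> carrier_mat n n" and diag: "\<And>i. i < n \<Longrightarrow> A $$ (i, i) = 2"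
    and "k \<le> n" and c: "c < n"
  defines "Q \<equiv> \<lambda>k. foldr (*) (map (reflection A) [k..<n]) (1\<^sub>m n)"
  shows "(\<forall>i<k. Q k $$ (i, c) = of_bool (i = c)) \<and>
    (\<forall>i. k \<le> i \<and> i < n \<longrightarrow>
      (\<Sum>j<n. A_plus A $$ (i, j) * Q k $$ (j, c)) = - A_minus A $$ (c, i))"
  using \<open>k \<le> n\<close>
proof (induction k rule: inc_induct)
  case base
  \<comment> \<open>At \<open>k = n\<close> the tail is the identity and the second claim is
    vacuous.\<close>
  show ?case using c by (auto simp: Q_def)
next
  case (step k)
  have dim: "dim_row A = n" using A by auto
  let ?Q = "Q (Suc k)"
  let ?S = "\<Sum>j<n. A $$ (k, j) * ?Q $$ (j, c)"
  have "Q k = reflection A k * ?Q"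
    using step.hyps by (simp add: Q_def upt_conv_Cons)
  moreover have "?Q \<in> carrier_mat n n"
    unfolding Q_def by (rule tail_prod_carrier[OF A])
  ultimately have Qk: "Q k $$ (i, c) = ?Q $$ (i, c) - of_bool (i = k) * ?S" if "i < n" for i
    using reflection_mult_index[OF A _ that c] by simp
  have top: "?Q $$ (i, c) = of_bool (i = c)" if "i \<le> k" for i
    using step.IH that by auto
  have "(\<Sum>j<n. A_plus A $$ (i, j) * Q k $$ (j, c)) = - A_minus A $$ (c, i)"
    if i: "k < i" "i < n" for i
  proof -
    have "(\<Sum>j<n. A_plus A $$ (i, j) * Q k $$ (j, c))
        = (\<Sum>j<n. A_plus A $$ (i, j) * ?Q $$ (j, c))"
      \<comment> \<open>The changed row \<open>k\<close> is weighted by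
        \<open>A_plus A $$ (i, k)\<close>, which is 0 below the diagonal.\<close>
      using i dim by (intro sum.cong) (auto simp: Qk A_plus_def)
    thus ?thesis using step.IH i by auto
  qed
  moreover have "(\<Sum>j<n. A_plus A $$ (k, j) * Q k $$ (j, c)) = - A_minus A $$ (c, k)"
  proof -
    have "(\<Sum>j<n. A_plus A $$ (k, j) * Q k $$ (j, c))
        = (\<Sum>j<n. A_plus A $$ (k, j) * ?Q $$ (j, c) - of_bool (j = k) * ?S)"
      \<comment> \<open>The diagonal entry 1 of \<open>A_plus A\<close> passes the change
        \<open>?S\<close> on with coefficient 1.\<close>
      using step.hyps dim by (intro sum.cong) (auto simp: Qk A_plus_def algebra_simps)
    also have "\<dots> = (\<Sum>j<n. A_plus A $$ (k, j) * ?Q $$ (j, c)) - ?S"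
      using step.hyps
      by (simp add: sum_subtractf of_bool_def if_distrib[of "\<lambda>x. x * _"] cong: if_cong)
    also have "\<dots> = (\<Sum>j<n. (A_plus A $$ (k, j) - A $$ (k, j)) * ?Q $$ (j, c))"
      by (simp add: sum_subtractf left_diff_distrib)
    \<comment> \<open>For \<open>j > k\<close> both sides vanish by triangularity. For
      \<open>j \<le> k\<close> row \<open>j\<close> of \<open>?Q\<close> is an identity row, and at
      \<open>j = k\<close> the coefficient is 1 - 2 = -1.\<close>
    also have "\<dots> = (\<Sum>j<n. if j = c then - A_minus A $$ (j, k) else 0)"
    proof (intro sum.cong refl)
      fix j assume "j \<in> {..<n}"
      thus "(A_plus A $$ (k, j) - A $$ (k, j)) * ?Q $$ (j, c)
          = (if j = c then - A_minus A $$ (j, k) else 0)"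
        using step.hyps dim diag top[of j] by (cases "j \<le> k") (auto simp: A_plus_def A_minus_def)
    qed
    also have "\<dots> = - A_minus A $$ (c, k)"
      using c by simp
    finally show ?thesis .
  qed
  ultimately show ?case
    using Qk top step.hyps by (auto simp: le_less)
qed

text \<open>This clears the inverse from the theorem: at \<open>k = 0\<close> the tail is the whole
  product, and the second claim of \<open>tail_prod_rows\<close> covers every row.\<close>

lemma A_plus_mult_reflection_prod:
  fixes A :: "'a :: comm_ring_1 mat"
  assumes A: "A \<in> carrier_mat n n" and "\<And>i. i < n \<Longrightarrow> A $$ (i, i) = 2"
  shows "A_plus A * reflection_prod A = - transpose_mat (A_minus A)"
proof (rule eq_matI)
  have dim: "dim_row A = n" using A by auto
  have P: "reflection_prod A \<in> carrier_mat n n"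
    using tail_prod_carrier[OF A] by (simp add: reflection_prod_def dim)
  fix i c
  assume "i < dim_row (- transpose_mat (A_minus A))" "c < dim_col (- transpose_mat (A_minus A))"
  hence "i < n" "c < n" by (auto simp: A_minus_def dim)
  moreover from this have "(A_plus A * reflection_prod A) $$ (i, c)
      = (\<Sum>j<n. A_plus A $$ (i, j) * reflection_prod A $$ (j, c))"
    using P by (auto simp: scalar_prod_def lessThan_atLeast0 A_plus_def dim intro!: sum.cong)
  ultimately show "(A_plus A * reflection_prod A) $$ (i, c)
      = (- transpose_mat (A_minus A)) $$ (i, c)"
    using tail_prod_rows[OF assms, of 0 c] by (simp add: reflection_prod_def dim A_minus_def)
qed (use tail_prod_carrier[OF A] A in \<open>auto simp: reflection_prod_def A_plus_def A_minus_def\<close>)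

theorem theorem2p9:
  fixes A :: "'a :: comm_ring_1 mat" and n :: nat
  assumes "A \<in> carrier_mat n n"
    and "\<And>i. i < n \<Longrightarrow> A $$ (i, i) = 2"
  shows "reflection_prod A = - (mat_inv (A_plus A) * transpose_mat (A_minus A))"
proof -
  \<comment> \<open>\<open>A_plus A\<close> is a unit, being unitriangular, so
    \<open>mat_inv\<close> yields its two-sided inverse.\<close>
  note inv = mat_inv_inverse[OF A_plus_Units[OF assms(1)]]
  have dim: "dim_row A = n" using assms(1) by auto
  have P: "reflection_prod A \<in> carrier_mat n n"
    using tail_prod_carrier[OF assms(1)] by (simp add: reflection_prod_def dim)
  have plus: "A_plus A \<in> carrier_mat n n" and minus: "transpose_mat (A_minus A) \<in> carrier_mat n n"
    by (auto simp: A_plus_def A_minus_def dim)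
  have "reflection_prod A = mat_inv (A_plus A) * A_plus A * reflection_prod A"
    using P inv by simp
  also have "\<dots> = mat_inv (A_plus A) * - transpose_mat (A_minus A)"
    using assoc_mult_mat[OF inv(1) plus P] A_plus_mult_reflection_prod[OF assms] by simp
  also have "\<dots> = - (mat_inv (A_plus A) * transpose_mat (A_minus A))"
    using inv(1) minus by simp
  finally show ?thesis .
qed

end
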